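(* In first-order predicate calculus with equality (no set-theoretic axioms), for all $y, z$ the formula $$\exists b\, b \in z \rightarrow \exists a (a \in z \wedge a \in y \wedge \forall b (b \in z \wedge b \in y \rightarrow b = a))$$ is equivalent to the formula $$\exists a \forall b\, \big[(b \in z \rightarrow a \in z \wedge a \in y) \wedge (a \in z \wedge a \in y \rightarrow (b \in z \wedge b \in y \rightarrow b = a))\big].$$ Consequently, for all $x, y$, the statement $C(y,x)$ ("$y$ is a choice-set for $x$") is equivalent to the following formula with only 3 quantifiers: $$\forall z \Big(z \in x \rightarrow \exists a \forall b\, \big[(b \in z \rightarrow a \in z \wedge a \in y) \wedge (a \in z \wedge a \in y \rightarrow (b \in z \wedge b \in y \rightarrow b = a))\big]\Big).$$
   Context: The language is first-order predicate calculus with equality and one binary relation symbol $\in$ (models have non-empty domain). $C(y,x)$ ("$y$ is a choice-set for $x$": for every non-empty $z \in x$, the intersection $z \cap y$ is a singleton) is $$\forall z \in x\, (\exists b\, b \in z \rightarrow \exists a (a \in z \wedge a \in y \wedge \forall b (b \in z \wedge b \in y \rightarrow b = a))).$$ *)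

theory Defs
  imports Main
begin

type_synonym var = nat

datatype fm =
    Mem var var        (infix "\<^bold>\<in>" 80)
  | Eq var var         (infix "\<^bold>=" 80)
  | Neg fm             ("\<^bold>\<not> _" [75] 75)
  | Con fm fm          (infixr "\<^bold>\<and>" 70)
  | Dis fm fm          (infixr "\<^bold>\<or>" 65)
  | Imp fm fm          (infixr "\<^bold>\<longrightarrow>" 60)
  | Iff fm fm          (infix "\<^bold>\<longleftrightarrow>" 55)
  | All var fm         ("(3\<^bold>\<forall>_./ _)" [0, 50] 50)
  | Ex var fm          ("(3\<^bold>\<exists>_./ _)" [0, 50] 50)

(* The domain of a model is the whole type 'u (types are non-empty), E interprets
   the membership symbol, and s assigns values to the variables.  Equality is
   interpreted as identity. *)
primrec sat :: "('u \<Rightarrow> 'u \<Rightarrow> bool) \<Rightarrow> (var \<Rightarrow> 'u) \<Rightarrow> fm \<Rightarrow> bool" where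
  "sat E s (u \<^bold>\<in> v) \<longleftrightarrow> E (s u) (s v)"
| "sat E s (u \<^bold>= v) \<longleftrightarrow> s u = s v"
| "sat E s (\<^bold>\<not> p) \<longleftrightarrow> \<not> sat E s p"
| "sat E s (p \<^bold>\<and> q) \<longleftrightarrow> sat E s p \<and> sat E s q"
| "sat E s (p \<^bold>\<or> q) \<longleftrightarrow> sat E s p \<or> sat E s q"
| "sat E s (p \<^bold>\<longrightarrow> q) \<longleftrightarrow> (sat E s p \<longrightarrow> sat E s q)"
| "sat E s (p \<^bold>\<longleftrightarrow> q) \<longleftrightarrow> (sat E s p \<longleftrightarrow> sat E s q)"
| "sat E s (\<^bold>\<forall>v. p) \<longleftrightarrow> (\<forall>d. sat E (s(v := d)) p)"
| "sat E s (\<^bold>\<exists>v. p) \<longleftrightarrow> (\<exists>d. sat E (s(v := d)) p)"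

(* Truth in every model with domain 'u; logical validity is obtained by leaving the
   type variable 'u schematic. *)
definition valid :: "'u itself \<Rightarrow> fm \<Rightarrow> bool" where
  "valid T p \<longleftrightarrow> (\<forall>(E :: 'u \<Rightarrow> 'u \<Rightarrow> bool) s. sat E s p)"

primrec num_quantifiers :: "fm \<Rightarrow> nat" where
  "num_quantifiers (u \<^bold>\<in> v) = 0"
| "num_quantifiers (u \<^bold>= v) = 0"
| "num_quantifiers (\<^bold>\<not> p) = num_quantifiers p"
| "num_quantifiers (p \<^bold>\<and> q) = num_quantifiers p + num_quantifiers q"
| "num_quantifiers (p \<^bold>\<or> q) = num_quantifiers p + num_quantifiers q"
| "num_quantifiers (p \<^bold>\<longrightarrow> q) = num_quantifiers p + num_quantifiers q"
| "num_quantifiers (p \<^bold>\<longleftrightarrow> q) = num_quantifiers p + num_quantifiers q"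
| "num_quantifiers (\<^bold>\<forall>v. p) = Suc (num_quantifiers p)"
| "num_quantifiers (\<^bold>\<exists>v. p) = Suc (num_quantifiers p)"

(* In the formulas below, a and b (and z in the last two) are the names of the bound
   variables; all variables passed are meant to be distinct. *)

definition meets_once :: "var \<Rightarrow> var \<Rightarrow> var \<Rightarrow> var \<Rightarrow> fm" where
  "meets_once a b y z =
     ((\<^bold>\<exists>b. b \<^bold>\<in> z) \<^bold>\<longrightarrow>
      (\<^bold>\<exists>a. a \<^bold>\<in> z \<^bold>\<and> a \<^bold>\<in> y \<^bold>\<and> (\<^bold>\<forall>b. b \<^bold>\<in> z \<^bold>\<and> b \<^bold>\<in> y \<^bold>\<longrightarrow> b \<^bold>= a)))"

definition meets_once_short :: "var \<Rightarrow> var \<Rightarrow> var \<Rightarrow> var \<Rightarrow> fm" where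
  "meets_once_short a b y z =
     (\<^bold>\<exists>a. \<^bold>\<forall>b. (b \<^bold>\<in> z \<^bold>\<longrightarrow> a \<^bold>\<in> z \<^bold>\<and> a \<^bold>\<in> y) \<^bold>\<and>
        (a \<^bold>\<in> z \<^bold>\<and> a \<^bold>\<in> y \<^bold>\<longrightarrow> (b \<^bold>\<in> z \<^bold>\<and> b \<^bold>\<in> y \<^bold>\<longrightarrow> b \<^bold>= a)))"

(* C(y,x) *)
definition choice_set :: "var \<Rightarrow> var \<Rightarrow> var \<Rightarrow> var \<Rightarrow> var \<Rightarrow> fm" where
  "choice_set a b z y x = (\<^bold>\<forall>z. z \<^bold>\<in> x \<^bold>\<longrightarrow> meets_once a b y z)"

definition choice_set_short :: "var \<Rightarrow> var \<Rightarrow> var \<Rightarrow> var \<Rightarrow> var \<Rightarrow> fm" where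
  "choice_set_short a b z y x = (\<^bold>\<forall>z. z \<^bold>\<in> x \<^bold>\<longrightarrow> meets_once_short a b y z)"

end

theory Submission
  imports Defs
begin

text \<open>If z is non-empty, the clause \<open>b \<in> z \<longrightarrow> a \<in> z \<and> a \<in> y\<close> for all b puts a into the
  intersection of z and y, and the second clause says that it is the only element there.
  If z is empty, both clauses hold for every a, so any element of the (non-empty) domain is a witness.\<close>

lemma sat_meets_once_short_iff:
  assumes "distinct [a, b, y, z]"
  shows "sat E s (meets_once_short a b y z) \<longleftrightarrow> sat E s (meets_once a b y z)"
proof -
  \<comment> \<open>Since the variables are distinct, assigning \<open>d\<close> to \<open>a\<close>
    and \<open>e\<close> to \<open>b\<close> changes neither \<open>s y\<close> nor
    \<open>s z\<close>, and the update at \<open>b\<close> keeps the value of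
    \<open>a\<close>.\<close>
  have short: "sat E s (meets_once_short a b y z) \<longleftrightarrow>
      (\<exists>d. \<forall>e. (E e (s z) \<longrightarrow> E d (s z) \<and> E d (s y)) \<and>
        (E d (s z) \<and> E d (s y) \<longrightarrow> E e (s z) \<and> E e (s y) \<longrightarrow> e = d))"
    using assms by (auto simp: meets_once_short_def)
  have once: "sat E s (meets_once a b y z) \<longleftrightarrow>
      ((\<exists>e. E e (s z)) \<longrightarrow>
        (\<exists>d. E d (s z) \<and> E d (s y) \<and> (\<forall>e. E e (s z) \<and> E e (s y) \<longrightarrow> e = d)))"
    using assms by (auto simp: meets_once_def)
  show ?thesis
    unfolding short once by blast
qed

theorem corollary2p3:
  fixes a b x y z :: var
  assumes "distinct [a, b, x, y, z]"
  shows "valid TYPE('u)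
           (\<^bold>\<forall>y. \<^bold>\<forall>z. meets_once a b y z \<^bold>\<longleftrightarrow> meets_once_short a b y z)
       \<and> valid TYPE('u)
           (\<^bold>\<forall>x. \<^bold>\<forall>y. choice_set a b z y x \<^bold>\<longleftrightarrow> choice_set_short a b z y x)
       \<and> num_quantifiers (choice_set_short a b z y x) = 3"
  using assms
  \<comment> \<open>The lemma holds for every assignment, hence also for those updated by the outer
    quantifiers.\<close>
  by (simp add: valid_def choice_set_def choice_set_short_def sat_meets_once_short_iff)
    \<comment> \<open>What is left is to count the two quantifiers of
      \<open>meets_once_short\<close>; unfolding it earlier would keep the lemma from
      matching.\<close>
    (simp add: meets_once_short_def)

end
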